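(* For the Fibonacci-Dyck shift $F$, the multiplier $\alpha(1)$ is exceptional only at period two; that is, for $n\in\mathbb N$ the multiplier $\alpha(1)$ is exceptional at period $n$ if and only if $n=2$.
   Context: The Dyck inverse monoid $\mathcal D_2$ is the monoid with zero generated by $\alpha_-(0),\alpha_-(1),\alpha_+(0),\alpha_+(1)$ with relations $\alpha_-(n)\alpha_+(m)=\mathbf 1$ if $n=m$ and $=0$ if $n\ne m$. Let $\mathcal D_2^-$ (resp. $\mathcal D_2^+$) be the free semigroup (without identity) generated in $\mathcal D_2$ by $\alpha_-(0),\alpha_-(1)$ (resp. $\alpha_+(0),\alpha_+(1)$). Fibonacci-Dyck shift $F$: consider the directed graph with vertices $0,1$ and six edges: $\beta^-(0)$ and $\beta^+(0)$ are loops at vertex $0$; $\beta^-$ goes from $0$ to $1$; $\beta^-(1)$ goes from $1$ to $0$; $\beta^+$ goes from $1$ to $0$; $\beta^+(1)$ goes from $0$ to $1$. Label the edges by $\lambda(\beta^-(i))=\alpha_-(i)$, $\lambda(\beta^+(i))=\alpha_+(i)$ for $i=0,1$, and $\lambda(\beta^-)=\lambda(\beta^+)=\mathbf 1$, and for a directed path $b=(b_1,\dots,b_I)$ set $\lambda(b)=\lambda(b_1)\cdots\lambda(b_I)\in\mathcal D_2$. $F$ is the subshift over the six-letter alphabet of edges whose admissible words are exactly the finite directed paths $b$ with $\lambda(b)\neq 0$. Multipliers: a word in the symbols $\alpha(0),\alpha(1)$ is primitive if it is nonempty and not a proper power of another word; a multiplier is an equivalence class of primitive words under cyclic permutation, denoted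 by any representative. Let $p\in F$ be periodic with smallest period $\Pi(p)$ (the length of its orbit), and write $p_{[i,i+\Pi(p))}=(p_i,\dots,p_{i+\Pi(p)-1})$. The point $p$ and its orbit have negative (resp. positive) multiplier if $\lambda(p_{[i,i+\Pi(p))})\in\mathcal D_2^-$ (resp. $\in\mathcal D_2^+$) for some $i\in\mathbb Z$. For a multiplier $\mu$, they have negative multiplier $\mu_-$ if there are $i\in\mathbb Z$, a representative $\alpha(n_1)\cdots\alpha(n_J)$ of $\mu$ and $\kappa\in\mathbb N$ ($\kappa\geq1$) with $\lambda(p_{[i,i+\Pi(p))})=(\alpha_-(n_1)\cdots\alpha_-(n_J))^\kappa$; they have positive multiplier $\mu_+$ if there are such data with $\lambda(p_{[i,i+\Pi(p))})=(\alpha_+(n_J)\cdots\alpha_+(n_1))^\kappa$. For $n\in\mathbb N$ let $\mathcal O_n^-$, $\mathcal O_n^+$, $\mathcal O_n(\mu_-)$, $\mathcal O_n(\mu_+)$ be the sets of periodic orbits of $F$ of length $n$ with, respectively, negative multiplier, positive multiplier, multiplier $\mu_-$, multiplier $\mu_+$. A multiplier $\mu$ is exceptional at period $n$ if $\operatorname{card}(\mathcal O_n(\mu_-)\cup\mathcal O_n(\mu_+))>\max\{\operatorname{card}(\mathcal O_n^-),\operatorname{card}(\mathcal O_n^+)\}$. *)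

theory Defs
  imports Complex_Main "HOL-Library.Z2"
begin

text \<open>The type \<open>bit\<close> serves only as the index set with the two elements \<open>0\<close> and \<open>1\<close>;
  its field structure is not used.\<close>

datatype gen = Gneg bit | Gpos bit

text \<open>The free monoid with zero on a set of generators: words, together with an added
  zero \<^term>\<open>None\<close>.\<close>

fun fmult :: "gen list option \<Rightarrow> gen list option \<Rightarrow> gen list option" where
  "fmult (Some u) (Some v) = Some (u @ v)"
| "fmult None _ = None"
| "fmult _ None = None"

inductive dyck_cong :: "gen list option \<Rightarrow> gen list option \<Rightarrow> bool" where
  rel_one: "n = m \<Longrightarrow> dyck_cong (Some [Gneg n, Gpos m]) (Some [])"
| rel_zero: "n \<noteq> m \<Longrightarrow> dyck_cong (Some [Gneg n, Gpos m]) None"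
| dc_refl: "dyck_cong x x"
| dc_sym: "dyck_cong x y \<Longrightarrow> dyck_cong y x"
| dc_trans: "dyck_cong x y \<Longrightarrow> dyck_cong y z \<Longrightarrow> dyck_cong x z"
| dc_mult: "dyck_cong x x' \<Longrightarrow> dyck_cong y y' \<Longrightarrow> dyck_cong (fmult x y) (fmult x' y')"

quotient_type dyck = "gen list option" / dyck_cong
  by (auto intro!: equivpI reflpI sympI transpI intro: dc_refl dc_sym dc_trans)

lemma fmult_simps [simp]:
  "fmult x None = None" "fmult (Some []) x = x" "fmult x (Some []) = x"
  by (cases x; simp)+

lemma fmult_assoc: "fmult (fmult x y) z = fmult x (fmult y z)"
  by (cases x; cases y; cases z) simp_all

instantiation dyck :: "{monoid_mult, mult_zero}"
begin

lift_definition one_dyck :: dyck is "Some []" .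

lift_definition zero_dyck :: dyck is None .

lift_definition times_dyck :: "dyck \<Rightarrow> dyck \<Rightarrow> dyck" is fmult
  by (rule dc_mult)

instance
  by standard (transfer; simp add: fmult_assoc dc_refl)+

end

lift_definition alpha_neg :: "bit \<Rightarrow> dyck" is "\<lambda>n. Some [Gneg n]" .

lift_definition alpha_pos :: "bit \<Rightarrow> dyck" is "\<lambda>n. Some [Gpos n]" .

lemma alpha_neg_pos: "alpha_neg n * alpha_pos m = (if n = m then 1 else 0)"
  by transfer (auto intro: rel_one rel_zero)

definition dyck_minus :: "dyck set" where
  "dyck_minus = {prod_list (map alpha_neg w) | w. w \<noteq> []}"

definition dyck_plus :: "dyck set" where
  "dyck_plus = {prod_list (map alpha_pos w) | w. w \<noteq> []}"

text \<open>The edges $\beta^-(i)$, $\beta^+(i)$, $\beta^-$, $\beta^+$, in this order. The vertices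
  are also indexed by \<open>bit\<close>.\<close>

datatype edge = BetaNegAt bit | BetaPosAt bit | BetaNeg | BetaPos

text \<open>$\beta^-(i)$ goes from \<open>i\<close> to \<open>0\<close> and $\beta^+(i)$ from \<open>0\<close> to \<open>i\<close>, so both are loops
  for \<open>i = 0\<close>.\<close>

fun src :: "edge \<Rightarrow> bit" where
  "src (BetaNegAt i) = i"
| "src (BetaPosAt i) = 0"
| "src BetaNeg = 0"
| "src BetaPos = 1"

fun tgt :: "edge \<Rightarrow> bit" where
  "tgt (BetaNegAt i) = 0"
| "tgt (BetaPosAt i) = i"
| "tgt BetaNeg = 1"
| "tgt BetaPos = 0"

fun edge_label :: "edge \<Rightarrow> dyck" where
  "edge_label (BetaNegAt i) = alpha_neg i"
| "edge_label (BetaPosAt i) = alpha_pos i"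
| "edge_label BetaNeg = 1"
| "edge_label BetaPos = 1"

definition path_label :: "edge list \<Rightarrow> dyck" where
  "path_label b = prod_list (map edge_label b)"

definition directed_path :: "edge list \<Rightarrow> bool" where
  "directed_path b \<longleftrightarrow> successively (\<lambda>e f. tgt e = src f) b"

definition admissible :: "edge list \<Rightarrow> bool" where
  "admissible b \<longleftrightarrow> directed_path b \<and> path_label b \<noteq> 0"

text \<open>The block of length \<open>n\<close> starting at \<open>i\<close>, i.e. $p_{[i,i+n)}$.\<close>

definition block :: "(int \<Rightarrow> 'a) \<Rightarrow> int \<Rightarrow> nat \<Rightarrow> 'a list" where
  "block p i n = map (\<lambda>k. p (i + int k)) [0..<n]"

definition fib_dyck_shift :: "(int \<Rightarrow> edge) set" where
  "fib_dyck_shift = {p. \<forall>i n. admissible (block p i n)}"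

definition has_period :: "(int \<Rightarrow> 'a) \<Rightarrow> nat \<Rightarrow> bool" where
  "has_period p n \<longleftrightarrow> n \<ge> 1 \<and> (\<forall>i. p (i + int n) = p i)"

definition periodic :: "(int \<Rightarrow> 'a) \<Rightarrow> bool" where
  "periodic p \<longleftrightarrow> (\<exists>n. has_period p n)"

definition smallest_period :: "(int \<Rightarrow> 'a) \<Rightarrow> nat" where
  "smallest_period p = (LEAST n. has_period p n)"

definition shift_orbit :: "(int \<Rightarrow> 'a) \<Rightarrow> (int \<Rightarrow> 'a) set" where
  "shift_orbit p = {(\<lambda>i. p (i + k)) | k. True}"

text \<open>A word $\alpha(n_1)\cdots\alpha(n_J)$ is encoded by its list of indices.\<close>

definition primitive_word :: "'a list \<Rightarrow> bool" where
  "primitive_word w \<longleftrightarrow> w \<noteq> [] \<and> \<not> (\<exists>u k. k \<ge> 2 \<and> w = concat (replicate k u))"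

definition cyclic_perm :: "('a list \<times> 'a list) set" where
  "cyclic_perm = {(u, v). primitive_word u \<and> primitive_word v \<and> (\<exists>k. v = rotate k u)}"

definition multipliers :: "bit list set set" where
  "multipliers = {w. primitive_word w} // cyclic_perm"

definition multiplier_of :: "bit list \<Rightarrow> bit list set" where
  "multiplier_of w = cyclic_perm `` {w}"

lemma multiplier_of_singleton: "multiplier_of [i] = {[i]}" "multiplier_of [i] \<in> multipliers"
proof -
  have prim: "primitive_word [i]"
  proof -
    have False if "k \<ge> 2" "[i] = concat (replicate k u)" for u :: "bit list" and k
    proof -
      have "length [i] = k * length u"
        by (subst that(2)) (simp add: length_concat sum_list_replicate)
      with that(1) show False by simp
    qed
    then show ?thesis unfolding primitive_word_def by blast
  qed
  then show "multiplier_of [i] = {[i]}"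
    by (auto simp: multiplier_of_def cyclic_perm_def)
  from prim show "multiplier_of [i] \<in> multipliers"
    unfolding multipliers_def multiplier_of_def by (auto intro: quotientI)
qed

definition negative_multiplier :: "(int \<Rightarrow> edge) \<Rightarrow> bool" where
  "negative_multiplier p \<longleftrightarrow> (\<exists>i. path_label (block p i (smallest_period p)) \<in> dyck_minus)"

definition positive_multiplier :: "(int \<Rightarrow> edge) \<Rightarrow> bool" where
  "positive_multiplier p \<longleftrightarrow> (\<exists>i. path_label (block p i (smallest_period p)) \<in> dyck_plus)"

definition has_multiplier_neg :: "bit list set \<Rightarrow> (int \<Rightarrow> edge) \<Rightarrow> bool" where
  "has_multiplier_neg \<mu> p \<longleftrightarrow> (\<exists>i. \<exists>w\<in>\<mu>. \<exists>\<kappa>\<ge>1.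
     path_label (block p i (smallest_period p)) = prod_list (map alpha_neg w) ^ \<kappa>)"

definition has_multiplier_pos :: "bit list set \<Rightarrow> (int \<Rightarrow> edge) \<Rightarrow> bool" where
  "has_multiplier_pos \<mu> p \<longleftrightarrow> (\<exists>i. \<exists>w\<in>\<mu>. \<exists>\<kappa>\<ge>1.
     path_label (block p i (smallest_period p)) = prod_list (map alpha_pos (rev w)) ^ \<kappa>)"

definition periodic_orbits :: "nat \<Rightarrow> ((int \<Rightarrow> edge) \<Rightarrow> bool) \<Rightarrow> (int \<Rightarrow> edge) set set" where
  "periodic_orbits n P =
     {shift_orbit p | p. p \<in> fib_dyck_shift \<and> periodic p \<and> smallest_period p = n \<and> P p}"

text \<open>All sets of orbits below are finite, since the alphabet is finite and the length of the
  orbits is fixed, so \<^const>\<open>card\<close> is the true cardinality.\<close>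

definition exceptional :: "bit list set \<Rightarrow> nat \<Rightarrow> bool" where
  "exceptional \<mu> n \<longleftrightarrow>
     card (periodic_orbits n (has_multiplier_neg \<mu>) \<union> periodic_orbits n (has_multiplier_pos \<mu>))
     > max (card (periodic_orbits n negative_multiplier))
           (card (periodic_orbits n positive_multiplier))"

end

theory Submission
  imports Defs
begin

text \<open>Time reversal together with the exchange of signs is a symmetry of the shift that turns negative
  multipliers into positive ones (\<open>periodic_orbits_reversal\<close>). Hence \<open>\<O>\<^sub>n\<^sup>-\<close> and \<open>\<O>\<^sub>n\<^sup>+\<close> have equal
  cardinality, and so have the two sets of orbits with multiplier \<open>\<alpha>(1)\<^sub>-\<close> and \<open>\<alpha>(1)\<^sub>+\<close>. The
  multiplier \<open>\<alpha>(1)\<close> therefore fails to be exceptional as soon as at most half of the negative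
  orbits of length \<open>n\<close> have multiplier \<open>\<alpha>(1)\<^sub>-\<close>.

  For \<open>n \<noteq> 2\<close> this follows from an injection of the orbits with multiplier \<open>\<alpha>(1)\<^sub>-\<close> into the
  other negative orbits (\<open>twice_card_multiplier_one_le\<close>). It replaces a single unmatched
  \<open>\<beta>\<^sup>-(1)\<close> and the edge preceding it by two edges \<open>\<beta>\<^sup>-(0)\<close>, so that the length is kept and the
  label acquires two adjacent letters \<open>\<alpha>\<^sub>-(0)\<close>. These mark the place of the exchange in the cyclic
  word, which makes it reversible (\<open>swapped_rotation_trivial\<close>, \<open>swapped_inj\<close>). Which of
  the unmatched edges is exchanged does not matter and is left to a choice. An exchange is
  possible unless the cyclic word is a power of \<open>\<beta>\<^sup>- \<beta>\<^sup>-(1)\<close> (\<open>unswapped_decomposition\<close>), and the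
  orbit of that word has period two, where it is the only negative orbit; there
  \<open>\<alpha>(1)\<close> accounts for two orbits against one (\<open>exceptional_two\<close>).\<close>

section \<open>The Dyck monoid acting on stacks\<close>

fun pop :: "bit \<Rightarrow> bit list \<Rightarrow> bit list option" where
  "pop i [] = None"
| "pop i (j # s) = (if j = i then Some s else None)"

text \<open>The Dyck monoid acts from the right by partial maps on stacks of bits: a negative generator
  pushes its index, a positive one pops its index and is undefined on any other stack. Reading
  a word on the empty stack decides whether it represents an element of the free monoid on the
  negative generators, and which one, without any normal form theory.\<close>

fun act_gen :: "gen \<Rightarrow> bit list \<Rightarrow> bit list option" where
  "act_gen (Gneg i) s = Some (i # s)"
| "act_gen (Gpos i) s = pop i s"

fun act_word :: "gen list \<Rightarrow> bit list \<Rightarrow> bit list option" where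
  "act_word [] s = Some s"
| "act_word (g # w) s = Option.bind (act_gen g s) (act_word w)"

lemma act_word_append: "act_word (u @ v) s = Option.bind (act_word u s) (act_word v)"
  by (induction u arbitrary: s) (auto split: bind_split)

fun act_zero_word :: "gen list option \<Rightarrow> bit list \<Rightarrow> bit list option" where
  "act_zero_word None s = None"
| "act_zero_word (Some w) s = act_word w s"

lemma act_zero_word_fmult:
  "act_zero_word (fmult x y) s = Option.bind (act_zero_word x s) (act_zero_word y)"
  by (cases x; cases y) (auto simp: act_word_append split: bind_split)

lemma act_zero_word_cong: "dyck_cong x y \<Longrightarrow> act_zero_word x = act_zero_word y"
  by (induction rule: dyck_cong.induct) (auto intro!: ext simp: act_zero_word_fmult)

lift_definition act :: "dyck \<Rightarrow> bit list \<Rightarrow> bit list option" is act_zero_word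
  by (rule act_zero_word_cong)

lemma act_zero [simp]: "act 0 s = None"
  by transfer simp

lemma act_one [simp]: "act 1 s = Some s"
  by transfer simp

lemma act_alpha_neg [simp]: "act (alpha_neg i) s = Some (i # s)"
  by transfer simp

lemma act_alpha_pos [simp]: "act (alpha_pos i) s = pop i s"
  by transfer (simp split: bind_split)

lemma act_mult: "act (x * y) s = Option.bind (act x s) (act y)"
  by transfer (rule act_zero_word_fmult)

fun step :: "edge \<Rightarrow> bit list \<Rightarrow> bit list option" where
  "step (BetaNegAt i) s = Some (i # s)"
| "step (BetaPosAt i) s = pop i s"
| "step BetaNeg s = Some s"
| "step BetaPos s = Some s"

fun run :: "edge list \<Rightarrow> bit list \<Rightarrow> bit list option" where
  "run [] s = Some s"
| "run (e # u) s = Option.bind (step e s) (run u)"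

lemma run_append: "run (u @ v) s = Option.bind (run u s) (run v)"
  by (induction u arbitrary: s) (auto split: bind_split)

lemma act_edge_label: "act (edge_label e) = step e"
  by (rule ext, cases e) auto

lemma act_path_label: "act (path_label u) = run u"
  by (induction u) (auto intro!: ext simp: path_label_def act_mult act_edge_label)

lemma path_label_nonzero: "run u s = Some t \<Longrightarrow> path_label u \<noteq> 0"
  by (metis act_path_label act_zero option.distinct(1))

abbreviation neg_word :: "bit list \<Rightarrow> dyck" where
  "neg_word w \<equiv> prod_list (map alpha_neg w)"

lemma act_neg_word: "act (neg_word w) s = Some (rev w @ s)"
  by (induction w arbitrary: s) (simp_all add: act_mult)

lemma neg_word_step: "step e s = Some t \<Longrightarrow> neg_word (rev s) * edge_label e = neg_word (rev t)"
proof (cases e)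
  case (BetaPosAt i)
  then show "step e s = Some t \<Longrightarrow> ?thesis"
    by (cases s) (auto simp: mult.assoc alpha_neg_pos split: if_splits)
qed auto

text \<open>The stack records the element reached so far: multiplying it by a label is one step of the
  action. This is the converse direction to evaluating \<open>act\<close> at the empty stack.\<close>

lemma neg_word_run: "run u s = Some t \<Longrightarrow> neg_word (rev s) * path_label u = neg_word (rev t)"
proof (induction u arbitrary: s)
  case Nil
  then show ?case by (simp add: path_label_def)
next
  case (Cons e u)
  then obtain r where r: "step e s = Some r" "run u r = Some t"
    by (auto split: bind_splits)
  have "neg_word (rev s) * path_label (e # u) = neg_word (rev s) * edge_label e * path_label u"
    by (simp add: path_label_def mult.assoc)
  with r Cons.IH show ?case by (simp add: neg_word_step)
qed

lemma path_label_eq_neg_word_iff: "path_label u = neg_word w \<longleftrightarrow> run u [] = Some (rev w)"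
proof
  assume "path_label u = neg_word w"
  then show "run u [] = Some (rev w)" by (metis act_path_label act_neg_word append_Nil2)
next
  assume "run u [] = Some (rev w)"
  from neg_word_run[OF this] show "path_label u = neg_word w" by simp
qed

lemma path_label_in_dyck_minus_iff:
  "path_label u \<in> dyck_minus \<longleftrightarrow> (\<exists>t. t \<noteq> [] \<and> run u [] = Some t)"
  unfolding dyck_minus_def by (auto simp: path_label_eq_neg_word_iff) (metis rev_rev_ident rev_is_Nil_conv)

lemma neg_word_power: "neg_word [i] ^ k = neg_word (replicate k i)"
  by (induction k) simp_all

lemma path_label_eq_neg_power_iff:
  "path_label u = neg_word [i] ^ k \<longleftrightarrow> run u [] = Some (replicate k i)"
  by (simp only: neg_word_power path_label_eq_neg_word_iff rev_replicate)

lemma step_extend: "step e s = Some t \<Longrightarrow> step e (s @ r) = Some (t @ r)"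
  by (cases e; cases s) (auto split: if_splits)

lemma run_extend: "run u s = Some t \<Longrightarrow> run u (s @ r) = Some (t @ r)"
  by (induction u arbitrary: s) (auto split: bind_splits simp: step_extend)

lemma run_append_Nil:
  "run u [] = Some s \<Longrightarrow> run v [] = Some t \<Longrightarrow> run (u @ v) [] = Some (t @ s)"
  using run_extend[of v "[]" t s] by (simp add: run_append)

lemma run_append_Some:
  "run (u @ v) s = Some t \<longleftrightarrow> (\<exists>r. run u s = Some r \<and> run v r = Some t)"
  by (simp add: run_append Option.bind_eq_Some_conv)

lemma run_snoc_neg: "run (u @ [BetaNegAt i]) s = Some t \<longleftrightarrow> (\<exists>r. t = i # r \<and> run u s = Some r)"
  by (auto simp: run_append split: bind_splits)

text \<open>The bracket structure: the top of the final stack was pushed by some edge and stayed there,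
  so everything read after that edge is balanced.\<close>

lemma run_last_passage:
  assumes "run u [] = Some (i # s)"
  shows "\<exists>y x. u = y @ BetaNegAt i # x \<and> run y [] = Some s \<and> run x [] = Some []"
  using assms
proof (induction u arbitrary: i s rule: length_induct)
  case (1 u)
  show ?case
  proof (cases u rule: rev_cases)
    case Nil
    with 1 show ?thesis by simp
  next
    case (snoc z e)
    with 1 obtain r where r: "run z [] = Some r" "step e r = Some (i # s)"
      by (auto simp: run_append_Some Option.bind_eq_Some_conv)
    have IH: "\<exists>y x. w = y @ BetaNegAt j # x \<and> run y [] = Some t \<and> run x [] = Some []"
      if "run w [] = Some (j # t)" "length w \<le> length z" for w j t
      using 1(1) that snoc by auto
    have skip: ?thesis if zi: "run z [] = Some (i # s)" "\<And>t. step e t = Some t"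
    proof -
      from IH[OF zi(1)] obtain y x where
        "z = y @ BetaNegAt i # x" "run y [] = Some s" "run x [] = Some []" by auto
      with snoc zi(2) show ?thesis
        by (intro exI[of _ y] exI[of _ "x @ [e]"]) (simp add: run_append)
    qed
    show ?thesis
    proof (cases e)
      case (BetaNegAt j)
      with r snoc show ?thesis by (intro exI[of _ z] exI[of _ "[]"]) auto
    next
      case (BetaPosAt j)
      with r(2) have "r = j # i # s" by (cases r) (auto split: if_splits)
      with IH r(1) obtain y x where
        yx: "z = y @ BetaNegAt j # x" "run y [] = Some (i # s)" "run x [] = Some []" by blast
      with IH obtain y' x' where
        "y = y' @ BetaNegAt i # x'" "run y' [] = Some s" "run x' [] = Some []" by fastforce
      with snoc yx BetaPosAt run_extend[OF yx(3), of "[j]"] show ?thesis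
        by (intro exI[of _ y'] exI[of _ "x' @ BetaNegAt j # x @ [e]"]) (simp add: run_append)
    qed (use skip r in auto)
  qed
qed

text \<open>Of two candidates for the edge that pushed the top, the earlier one would have the later
  one inside the balanced word that follows it; but an edge inside a balanced word is
  popped again before the end of that word.\<close>

lemma last_passage_unique:
  assumes eq: "y @ BetaNegAt i # x = y' @ BetaNegAt i # x'"
    and x: "run x [] = Some []" and x': "run x' [] = Some []"
  shows "y = y'" "x = x'"
proof -
  have no: False if "run z [] = Some []" "z = c @ BetaNegAt i # w" "run w [] = Some []" for z c w
  proof -
    from that obtain r where "run c [] = Some r" "run (BetaNegAt i # w) r = Some []"
      by (auto simp: run_append_Some)
    with run_extend[OF that(3), of "i # r"] show False by simp
  qed
  have *: "y = y' \<and> x = x'"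
    if "us @ BetaNegAt i # x = BetaNegAt i # x'" "y = y' @ us" "run x [] = Some []" "run x' [] = Some []"
    for us y x y' x'
    using that no[OF that(4) _ that(3)] by (cases us) auto
  from eq have "y = y' \<and> x = x'"
    unfolding append_eq_append_conv2 using * x x' by metis
  then show "y = y'" "x = x'" by auto
qed

section \<open>Walks in the graph\<close>

fun walk :: "bit \<Rightarrow> edge list \<Rightarrow> bit \<Rightarrow> bool" where
  "walk a [] b \<longleftrightarrow> a = b"
| "walk a (e # u) b \<longleftrightarrow> src e = a \<and> walk (tgt e) u b"

lemma walk_append: "walk a (u @ v) b \<longleftrightarrow> (\<exists>c. walk a u c \<and> walk c v b)"
  by (induction u arbitrary: a) auto

lemma walk_directed_path: "walk a u b \<Longrightarrow> directed_path u"
  unfolding directed_path_def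
proof (induction u arbitrary: a)
  case (Cons e u)
  then show ?case by (cases u) auto
qed simp

section \<open>Exchanging an unmatched one for two unmatched zeros\<close>

text \<open>A cyclic word with label a power of \<open>\<alpha>\<^sub>-(1)\<close> is turned so that it ends in an unmatched
  \<open>\<beta>\<^sup>-(1)\<close>. The edge before it ends at vertex 1, hence is \<open>\<beta>\<^sup>+(1)\<close> or \<open>\<beta>\<^sup>-\<close>. The exchange
  replaces \<open>q \<beta>\<^sup>+(1) \<beta>\<^sup>-(1)\<close> by \<open>q \<beta>\<^sup>-(0) \<beta>\<^sup>-(0)\<close>, and \<open>q x \<beta>\<^sup>- \<beta>\<^sup>-(1)\<close> by
  \<open>q \<beta>\<^sup>-(0) x \<beta>\<^sup>-(0)\<close> for a nonempty balanced \<open>x\<close>. The two cases are merged by letting an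
  empty \<open>x\<close> stand for the first one, so that the result shows which case occurred. If \<open>q\<close>
  has the empty label, the whole balanced part is put into \<open>x\<close>; this normalisation makes
  the result primitive.\<close>

definition swappable :: "edge list \<Rightarrow> edge list \<Rightarrow> bool" where
  "swappable q x \<longleftrightarrow> walk 0 q 0 \<and> walk 0 x 0 \<and> run x [] = Some [] \<and>
     (\<exists>k. run q [] = Some (replicate k 1) \<and> (k = 0 \<longrightarrow> q = [] \<and> x \<noteq> []))"

definition unswapped :: "edge list \<Rightarrow> edge list \<Rightarrow> edge list" where
  "unswapped q x = q @ (if x = [] then [BetaPosAt 1, BetaNegAt 1] else x @ [BetaNeg, BetaNegAt 1])"

definition swapped :: "edge list \<Rightarrow> edge list \<Rightarrow> edge list" where
  "swapped q x = q @ BetaNegAt 0 # x @ [BetaNegAt 0]"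

lemma length_swapped: "length (swapped q x) = length (unswapped q x)"
  by (simp add: unswapped_def swapped_def)

lemma run_swapped:
  assumes "swappable q x"
  shows "\<exists>k. run (swapped q x) [] = Some (0 # 0 # replicate k 1) \<and> (k = 0 \<longrightarrow> q = [] \<and> x \<noteq> [])"
proof -
  from assms obtain k where k: "run q [] = Some (replicate k 1)" "k = 0 \<longrightarrow> q = [] \<and> x \<noteq> []"
    and x: "run x [] = Some []"
    unfolding swappable_def by blast
  have "run (swapped q x) [] = Some (0 # 0 # replicate k 1)"
    using k(1) run_extend[OF x, of "0 # replicate k 1"] by (simp add: swapped_def run_append)
  with k(2) show ?thesis by blast
qed

lemma walk_swapped: "swappable q x \<Longrightarrow> walk 0 (swapped q x) 0"
  by (auto simp: swappable_def swapped_def walk_append)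

lemma swapped_inj:
  assumes "swappable q x" "swappable q' x'" "swapped q x = swapped q' x'"
  shows "q = q'" "x = x'"
  using assms last_passage_unique[of q 0 x q' x']
  by (auto simp: swappable_def swapped_def)

text \<open>The exchange loses nothing on passing to cyclic words. Two results that are rotations of each
  other both end in an unmatched \<open>\<beta>\<^sup>-(0)\<close>, so a cut into two nonempty parts puts one of
  the two zeros of the label at the end of each part. As the two zeros are adjacent in both
  rotations, ones can separate them on neither side, so there are no ones at all. Then
  both words are \<open>\<beta>\<^sup>-(0) x \<beta>\<^sup>-(0)\<close> with \<open>x\<close> nonempty and balanced, and the cut would force
  \<open>x\<close> to be empty. Taking both words equal gives primitivity.\<close>

lemma swapped_rotation_trivial:
  assumes m: "swappable q x" "swappable q' x'"
    and ab: "swapped q x = a @ b" and ba: "swapped q' x' = b @ a"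
  shows "a = [] \<or> b = []"
proof (rule ccontr)
  assume "\<not> (a = [] \<or> b = [])"
  moreover have "last (a @ b) = BetaNegAt 0" "last (b @ a) = BetaNegAt 0"
    using ab[symmetric] ba[symmetric] by (simp_all add: swapped_def)
  ultimately obtain a1 b1 where a: "a = a1 @ [BetaNegAt 0]" and b: "b = b1 @ [BetaNegAt 0]"
    by (metis append_butlast_last_id last_appendR)
  from run_swapped[OF m(1)] obtain k where
    k: "run (a @ b) [] = Some (0 # 0 # replicate k 1)" "k = 0 \<longrightarrow> q = [] \<and> x \<noteq> []"
    unfolding ab by blast
  from run_swapped[OF m(2)] obtain k' where
    k': "run (b @ a) [] = Some (0 # 0 # replicate k' 1)" "k' = 0 \<longrightarrow> q' = [] \<and> x' \<noteq> []"
    unfolding ba by blast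
  from k(1) obtain s where s: "run a1 [] = Some s" "run a [] = Some (0 # s)"
    by (auto simp: a run_append_Some)
  from k'(1) obtain t where t: "run b1 [] = Some t" "run b [] = Some (0 # t)"
    by (auto simp: b run_append_Some)
  have ts: "t @ 0 # s = 0 # replicate k 1"
    using run_append_Nil[OF s(2) t(2)] k(1) by simp
  have st: "s @ 0 # t = 0 # replicate k' 1"
    using run_append_Nil[OF t(2) s(2)] k'(1) by simp
  \<comment> \<open>once the top zero is removed, only one zero is left, with nothing above it\<close>
  have zero: "t' = []" if "t' @ 0 # s' = 0 # replicate l (1::bit)" for t' s' l
  proof (rule ccontr)
    assume "t' \<noteq> []"
    with that obtain t'' where "t'' @ 0 # s' = replicate l (1::bit)" by (cases t') auto
    then have "0 \<in> set (replicate l (1::bit))" by (metis in_set_conv_decomp)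
    then show False by (auto split: if_splits)
  qed
  from zero[OF ts] zero[OF st] have "t = []" "s = []" by auto
  with ts st k(2) k'(2) have q: "q = []" "q' = []" "x \<noteq> []" by auto
  have "[] @ BetaNegAt 0 # x = a1 @ BetaNegAt 0 # b1" "[] @ BetaNegAt 0 # x' = b1 @ BetaNegAt 0 # a1"
    using ab ba q by (simp_all add: swapped_def a b)
  with s t \<open>t = []\<close> \<open>s = []\<close> m q(3) show False
    using last_passage_unique[of "[]" 0 x a1 b1] last_passage_unique[of "[]" 0 x' b1 a1]
    by (auto simp: swappable_def)
qed

lemma swappable_append:
  assumes "walk 0 b 0" "run b [] = Some (replicate l 1)" "l = 0 \<longrightarrow> b = []" "swappable q x"
  shows "swappable (b @ q) x"
proof -
  from assms(4) obtain k where k: "run q [] = Some (replicate k 1)" "k = 0 \<longrightarrow> q = [] \<and> x \<noteq> []"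
    and "walk 0 q 0" "walk 0 x 0" "run x [] = Some []"
    unfolding swappable_def by blast
  moreover have "run (b @ q) [] = Some (replicate (k + l) 1)"
    using run_append_Nil[OF assms(2) k(1)] by (simp add: replicate_add)
  ultimately show ?thesis using assms unfolding swappable_def walk_append by auto
qed

text \<open>Cut the word from its end at the unmatched edges \<open>\<beta>\<^sup>-(1)\<close>. If the piece before such an edge
  is just \<open>\<beta>\<^sup>-\<close>, drop it and look at the previous one. When every piece is of this form, the
  word is a power of \<open>\<beta>\<^sup>- \<beta>\<^sup>-(1)\<close>; otherwise the exchange applies at the piece that was found.\<close>

lemma unswapped_decomposition:
  assumes "walk 0 u 0" "run u [] = Some (replicate k 1)" "u = [] \<or> last u = BetaNegAt 1"
  shows "(\<exists>j. u = concat (replicate j [BetaNeg, BetaNegAt 1])) \<or>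
    (\<exists>q x b l. u = unswapped q x @ b \<and> swappable q x \<and> walk 0 b 0 \<and>
       run b [] = Some (replicate l 1) \<and> (l = 0 \<longrightarrow> b = []))"
  using assms
proof (induction u arbitrary: k rule: length_induct)
  case (1 u)
  show ?case
  proof (cases "u = []")
    case True
    then show ?thesis by (intro disjI1 exI[of _ 0]) simp
  next
    case False
    define z where "z = butlast u"
    from False 1(4) have u: "u = z @ [BetaNegAt 1]"
      unfolding z_def by (metis append_butlast_last_id)
    from 1(3) obtain k' where k: "k = Suc k'" and runz: "run z [] = Some (replicate k' 1)"
      unfolding u run_snoc_neg by (cases k) auto
    from 1(2) have walkz: "walk 0 z 1" by (auto simp: u walk_append)
    then obtain z' e where z: "z = z' @ [e]" by (cases z rule: rev_cases) auto
    with walkz have walkz': "walk 0 z' 0" and e: "e = BetaNeg \<or> e = BetaPosAt 1"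
      by (cases e; auto simp: walk_append)+
    have last: ?thesis if "u = unswapped q x" "swappable q x" for q x
      using that by (intro disjI2 exI[of _ q] exI[of _ x] exI[of _ "[]"] exI[of _ 0]) simp
    from e show ?thesis
    proof
      assume e: "e = BetaPosAt 1"
      with z runz obtain s where "run z' [] = Some s" "pop 1 s = Some (replicate k' 1)"
        by (auto simp: run_append_Some Option.bind_eq_Some_conv)
      then have "run z' [] = Some (replicate (Suc k') 1)" by (cases s) (auto split: if_splits)
      with walkz' have "swappable z' []"
        unfolding swappable_def by (intro conjI exI[of _ "Suc k'"]) simp_all
      then show ?thesis by (rule last[rotated]) (simp add: u z e unswapped_def)
    next
      assume e: "e = BetaNeg"
      with z runz have runz': "run z' [] = Some (replicate k' 1)"
        by (auto simp: run_append_Some Option.bind_eq_Some_conv)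
      show ?thesis
      proof (cases k')
        case 0
        show ?thesis
        proof (cases "z' = []")
          case True
          then show ?thesis by (intro disjI1 exI[of _ 1]) (simp add: u z e)
        next
          case False
          with runz' walkz' 0 have "swappable [] z'" by (simp add: swappable_def)
          then show ?thesis using False by (intro last[of "[]" z']) (simp_all add: u z e unswapped_def)
        qed
      next
        case (Suc k'')
        with runz' obtain y x where yx: "z' = y @ BetaNegAt 1 # x"
          "run y [] = Some (replicate k'' 1)" "run x [] = Some []"
          using run_last_passage[of z' 1 "replicate k'' 1"] by auto
        define q where "q = y @ [BetaNegAt 1]"
        have q: "z' = q @ x" "run q [] = Some (replicate k' 1)"
          using yx Suc by (simp_all add: q_def run_append)
        have walks: "walk 0 q 0" "walk 0 x 0"
          using walkz' by (auto simp: q_def yx walk_append)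
        show ?thesis
        proof (cases "x = []")
          case False
          with q walks yx Suc have "swappable q x"
            unfolding swappable_def by (intro conjI exI[of _ k']) simp_all
          then show ?thesis using False by (intro last[of q x]) (simp_all add: u z e q unswapped_def)
        next
          case True
          then have uq: "u = q @ [BetaNeg, BetaNegAt 1]" by (simp add: u z e q)
          have "(\<exists>j. q = concat (replicate j [BetaNeg, BetaNegAt 1])) \<or>
            (\<exists>q' x b l. q = unswapped q' x @ b \<and> swappable q' x \<and> walk 0 b 0 \<and>
               run b [] = Some (replicate l 1) \<and> (l = 0 \<longrightarrow> b = []))"
            using 1(1) uq walks q(2) by (auto simp: q_def)
          then show ?thesis
          proof (elim disjE exE conjE)
            fix j assume "q = concat (replicate j [BetaNeg, BetaNegAt 1])"
            then show ?thesis
              by (intro disjI1 exI[of _ "j + 1"]) (simp only: uq replicate_add, simp)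
          next
            fix q' x b l
            assume *: "q = unswapped q' x @ b" "swappable q' x" "walk 0 b 0"
              "run b [] = Some (replicate l 1)"
            then have "run (b @ [BetaNeg, BetaNegAt 1]) [] = Some (replicate (Suc l) 1)"
              by (simp add: run_append)
            moreover have "walk 0 (b @ [BetaNeg, BetaNegAt 1]) 0"
              using * by (simp add: walk_append)
            ultimately show ?thesis using *
              by (intro disjI2 exI[of _ q'] exI[of _ x]
                  exI[of _ "b @ [BetaNeg, BetaNegAt 1]"] exI[of _ "Suc l"]) (simp add: uq)
          qed
        qed
      qed
    qed
  qed
qed

lemma unswapped_rotation:
  assumes "walk 0 u 0" "run u [] = Some (replicate k 1)" "last u = BetaNegAt 1"
    "\<And>j. u \<noteq> concat (replicate j [BetaNeg, BetaNegAt 1])"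
  shows "\<exists>a b q x. u = a @ b \<and> b @ a = unswapped q x \<and> swappable q x"
proof -
  from unswapped_decomposition[OF assms(1,2)] assms(3,4) obtain q x b l where
    "u = unswapped q x @ b" "swappable q x" "walk 0 b 0" "run b [] = Some (replicate l 1)"
    "l = 0 \<longrightarrow> b = []"
    by blast
  moreover have "b @ unswapped q x = unswapped (b @ q) x" by (simp add: unswapped_def)
  ultimately show ?thesis using swappable_append by blast
qed

section \<open>Periodic sequences, their blocks and their orbits\<close>

definition shift :: "(int \<Rightarrow> 'a) \<Rightarrow> int \<Rightarrow> int \<Rightarrow> 'a" where
  "shift p k = (\<lambda>i. p (i + k))"

lemma shift_shift [simp]: "shift (shift p k) l = shift p (k + l)"
  by (simp add: shift_def algebra_simps)

lemma shift_0 [simp]: "shift p 0 = p"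
  by (simp add: shift_def)

lemma shift_orbit_alt: "shift_orbit p = range (shift p)"
  by (auto simp: shift_orbit_def shift_def)

lemma shift_orbit_shift [simp]: "shift_orbit (shift p k) = shift_orbit p"
proof -
  have "shift p l \<in> range (\<lambda>j. shift p (k + j))" for l
    by (rule range_eqI[of _ _ "l - k"]) simp
  then show ?thesis by (auto simp: shift_orbit_alt)
qed

lemma shift_orbit_eq_iff: "shift_orbit p = shift_orbit q \<longleftrightarrow> (\<exists>k. q = shift p k)"
proof
  assume "shift_orbit p = shift_orbit q"
  moreover have "q \<in> shift_orbit q" unfolding shift_orbit_alt by (metis rangeI shift_0)
  ultimately show "\<exists>k. q = shift p k" by (auto simp: shift_orbit_alt)
qed auto

lemma length_block [simp]: "length (block p i n) = n"
  by (simp add: block_def)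

lemma nth_block [simp]: "k < n \<Longrightarrow> block p i n ! k = p (i + int k)"
  by (simp add: block_def)

lemma block_shift [simp]: "block (shift p k) i n = block p (i + k) n"
  by (simp add: block_def shift_def algebra_simps)

lemma block_0 [simp]: "block p i 0 = []"
  by (simp add: block_def)

lemma block_Suc: "block p i (Suc n) = p i # block p (i + 1) n"
  by (rule nth_equalityI) (auto simp: nth_Cons' of_nat_diff)

lemma block_add: "block p i (m + n) = block p i m @ block p (i + int m) n"
  by (rule nth_equalityI) (auto simp: nth_append of_nat_diff)

lemma has_period_shift [simp]: "has_period (shift p k) n \<longleftrightarrow> has_period p n"
proof -
  have "(\<forall>i. p (i + int n + k) = p (i + k)) \<longleftrightarrow> (\<forall>i. p (i + int n) = p i)"
    by (metis add.commute add.left_commute diff_add_cancel)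
  then show ?thesis by (simp add: has_period_def shift_def)
qed

lemma has_period_smallest: "periodic p \<Longrightarrow> has_period p (smallest_period p)"
  unfolding periodic_def smallest_period_def by (metis LeastI)

lemma smallest_period_le: "has_period p n \<Longrightarrow> smallest_period p \<le> n"
  unfolding smallest_period_def by (rule Least_le)

lemma has_period_mult:
  assumes "has_period p n"
  shows "p (i + int n * j) = p i"
proof -
  have step: "p (i + int n) = p i" for i using assms by (simp add: has_period_def)
  have nat: "p (i + int n * int m) = p i" for i m
  proof (induction m)
    case (Suc m)
    then show ?case using step[of "i + int n * int m"] by (simp add: algebra_simps)
  qed simp
  show ?thesis
  proof (cases "j \<ge> 0")
    case True
    then show ?thesis using nat[of i "nat j"] by simp
  next
    case False
    then show ?thesis using nat[of "i + int n * j" "nat (- j)"] by simp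
  qed
qed

lemma has_period_mod: "has_period p n \<Longrightarrow> p (i mod int n) = p i"
  using has_period_mult[of p n "i mod int n" "i div int n"] by simp

lemma block_mod:
  assumes "has_period p n"
  shows "block p (i mod int n) m = block p i m"
proof (rule nth_equalityI)
  fix k assume "k < length (block p (i mod int n) m)"
  moreover have "p (i mod int n + int k) = p (i + int k)"
    using has_period_mod[OF assms, of "i mod int n + int k"] has_period_mod[OF assms, of "i + int k"]
    by (simp add: mod_add_left_eq)
  ultimately show "block p (i mod int n) m ! k = block p i m ! k" by simp
qed simp

lemma block_rotate:
  assumes "has_period p n" "block p i n = a @ b"
  shows "block p (i + int (length a)) n = b @ a"
proof -
  have n: "n = length a + length b" using assms(2) by (metis length_append length_block)
  have "block p (i + int n) (length a) = block p i (length a)"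
    using block_mod[OF assms(1), of "i + int n"] block_mod[OF assms(1), of i] by simp
  moreover have "block p i (length a) = a" "block p (i + int (length a)) (length b) = b"
    using assms(2) by (auto simp: n block_add)
  ultimately show ?thesis
    using block_add[of p "i + int (length a)" "length b" "length a"] by (simp add: n algebra_simps)
qed

lemma block_split_at:
  assumes "has_period p n"
  shows "\<exists>a b. block p 0 n = a @ b \<and> block p k n = b @ a"
proof -
  define m where "m = nat (k mod int n)"
  have n: "n \<ge> 1" using assms by (simp add: has_period_def)
  then have m: "int m = k mod int n" "m < n"
    by (simp_all add: m_def nat_less_iff)
  have s: "block p 0 n = take m (block p 0 n) @ drop m (block p 0 n)" by simp
  from block_rotate[OF assms s] m have
    "block p (k mod int n) n = drop m (block p 0 n) @ take m (block p 0 n)"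
    by simp
  then show ?thesis using s block_mod[OF assms] by metis
qed

lemma shift_eq_shift:
  assumes "has_period p n" "has_period q n" "block p i n = block q j n"
  shows "shift p i = shift q j"
proof
  fix k
  have n: "n \<ge> 1" using assms(1) by (simp add: has_period_def)
  define m where "m = nat (k mod int n)"
  from n have m: "int m = k mod int n" "m < n" by (simp_all add: m_def nat_less_iff)
  have "r (l + int m) = r (l + k)" if "has_period r n" for r :: "int \<Rightarrow> 'a" and l
    using has_period_mod[OF that, of "l + int m"] has_period_mod[OF that, of "l + k"] m
    by (simp add: mod_add_right_eq)
  moreover have "p (i + int m) = q (j + int m)"
    using arg_cong[OF assms(3), of "\<lambda>u. u ! m"] m by simp
  ultimately show "shift p i k = shift q j k"
    using assms(1,2) unfolding shift_def by (metis add.commute)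
qed

text \<open>Primitive words, stated without powers: a smaller period would make the block equal to one
  of its proper rotations.\<close>

lemma smallest_period_eqI:
  assumes "has_period p n"
    and "\<And>a b. block p 0 n = a @ b \<Longrightarrow> b @ a = a @ b \<Longrightarrow> a = [] \<or> b = []"
  shows "smallest_period p = n"
proof (rule ccontr)
  assume ne: "smallest_period p \<noteq> n"
  define m where "m = smallest_period p"
  have m: "has_period p m" "m < n"
    using has_period_smallest assms(1) smallest_period_le[OF assms(1)] ne
    by (auto simp: periodic_def m_def)
  define a b where "a = take m (block p 0 n)" and "b = drop m (block p 0 n)"
  have ab: "block p 0 n = a @ b" by (simp add: a_def b_def)
  have "block p (int m) n = b @ a"
    using block_rotate[OF assms(1) ab] m(2) by (simp add: a_def)
  moreover have "block p (int m) n = block p 0 n"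
    using block_mod[OF m(1), of "int m" n] block_mod[OF m(1), of 0 n] by simp
  ultimately have "a = [] \<or> b = []" using assms(2) ab by simp
  moreover have "length a = m" "length b = n - m" using m(2) by (simp_all add: a_def b_def)
  ultimately show False using m by (auto simp: has_period_def)
qed

definition cyc :: "'a list \<Rightarrow> int \<Rightarrow> 'a" where
  "cyc u i = u ! nat (i mod int (length u))"

lemma has_period_cyc: "u \<noteq> [] \<Longrightarrow> has_period (cyc u) (length u)"
  by (simp add: has_period_def cyc_def Suc_le_eq)

lemma block_cyc: "block (cyc u) 0 (length u) = u"
  by (rule nth_equalityI) (simp_all add: cyc_def)

lemma shift_orbit_cyc_block:
  assumes "has_period p n"
  shows "shift_orbit (cyc (block p i n)) = shift_orbit p"
proof -
  have "block p i n \<noteq> []" using assms by (metis has_period_def length_block list.size(3) not_one_le_zero)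
  then have "has_period (cyc (block p i n)) n" using has_period_cyc[of "block p i n"] by simp
  moreover have "block (cyc (block p i n)) 0 n = block p i n" using block_cyc[of "block p i n"] by simp
  ultimately have "shift (cyc (block p i n)) 0 = shift p i" using assms by (intro shift_eq_shift)
  then show ?thesis by (metis shift_orbit_shift shift_0)
qed

section \<open>Periodic orbits of the shift\<close>

lemma UNIV_edge: "(UNIV :: edge set) = {BetaNegAt 0, BetaNegAt 1, BetaPosAt 0, BetaPosAt 1, BetaNeg, BetaPos}"
proof -
  have "e \<in> {BetaNegAt 0, BetaNegAt 1, BetaPosAt 0, BetaPosAt 1, BetaNeg, BetaPos}" for e
  proof (cases e)
    case (BetaNegAt i) then show ?thesis by (cases i) auto
  next
    case (BetaPosAt i) then show ?thesis by (cases i) auto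
  qed auto
  then show ?thesis by blast
qed

lemma finite_periodic_orbits: "finite (periodic_orbits n P)"
proof (rule finite_surj)
  have "finite (UNIV :: edge set)" by (subst UNIV_edge) simp
  then show "finite {u :: edge list. length u = n}"
    using finite_lists_length_eq[of "UNIV :: edge set" n] by simp
  show "periodic_orbits n P \<subseteq> (\<lambda>u. shift_orbit (cyc u)) ` {u. length u = n}"
    unfolding periodic_orbits_def
    using shift_orbit_cyc_block[OF has_period_smallest] by force
qed

lemma walk_block:
  assumes "p \<in> fib_dyck_shift"
  shows "walk (src (p i)) (block p i n) (src (p (i + int n)))"
proof (induction n arbitrary: i)
  case (Suc n)
  have "admissible (block p i (Suc (Suc 0)))" using assms by (simp add: fib_dyck_shift_def)
  then have "tgt (p i) = src (p (i + 1))"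
    by (simp add: admissible_def directed_path_def block_Suc)
  with Suc[of "i + 1"] show ?case by (simp add: block_Suc algebra_simps)
qed simp

text \<open>If one reading of the block on the empty stack succeeds, then so does any number of readings,
  since the stack left behind is never touched; hence every finite window has a nonzero label.\<close>

lemma fib_dyck_shiftI:
  assumes per: "has_period p n" and walk: "walk 0 (block p 0 n) 0"
    and run: "run (block p 0 n) [] = Some s"
  shows "p \<in> fib_dyck_shift"
proof -
  have rounds: "walk 0 (block p 0 (m * n)) 0 \<and> (\<exists>t. run (block p 0 (m * n)) [] = Some t)" for m
  proof (induction m)
    case (Suc m)
    have "block p 0 (Suc m * n) = block p 0 n @ block p 0 (m * n)"
      using block_mod[OF per, of "int n" "m * n"] block_mod[OF per, of 0 "m * n"]
      by (simp add: block_add)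
    with Suc walk run show ?case by (auto simp: walk_append intro: run_append_Nil)
  qed simp
  have "admissible (block p i m)" for i m
  proof -
    have n: "n \<ge> 1" using per by (simp add: has_period_def)
    define j where "j = nat (i mod int n)"
    from n have j: "int j = i mod int n" by (simp add: j_def)
    have "j + m \<le> (j + m) * n" using n by simp
    then obtain l where "(j + m) * n = j + m + l" by (metis le_add_diff_inverse)
    then have "block p 0 ((j + m) * n) = block p 0 j @ block p (int j) m @ block p (int (j + m)) l"
      by (simp add: block_add)
    then obtain a b s t where "walk a (block p (int j) m) b" "run (block p (int j) m) s = Some t"
      using rounds[of "j + m"] by (auto simp: walk_append run_append_Some)
    then show ?thesis
      unfolding admissible_def using block_mod[OF per, of i m]
      by (auto simp: j walk_directed_path path_label_nonzero)
  qed
  then show ?thesis by (simp add: fib_dyck_shift_def)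
qed

lemma negative_multiplier_iff:
  "negative_multiplier p \<longleftrightarrow>
     (\<exists>i t. t \<noteq> [] \<and> run (block p i (smallest_period p)) [] = Some t)"
  by (simp add: negative_multiplier_def path_label_in_dyck_minus_iff)

lemma has_multiplier_neg_iff:
  "has_multiplier_neg (multiplier_of [1]) p \<longleftrightarrow>
     (\<exists>i k. k \<ge> 1 \<and> run (block p i (smallest_period p)) [] = Some (replicate k 1))"
  by (simp add: has_multiplier_neg_def multiplier_of_singleton path_label_eq_neg_power_iff[simplified])

text \<open>Period two is excluded exactly because of the orbit of \<open>\<beta>\<^sup>- \<beta>\<^sup>-(1)\<close>, the only one with
  multiplier \<open>\<alpha>(1)\<^sub>-\<close> to which the exchange does not apply.\<close>

lemma unswapped_block_exists:
  assumes p: "p \<in> fib_dyck_shift" "has_period p n" "smallest_period p = n" "n \<noteq> 2"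
    and run: "run (block p i n) [] = Some (replicate k 1)" "k \<ge> 1"
  shows "\<exists>j q x. block p j n = unswapped q x \<and> swappable q x"
proof -
  from run obtain k' where k: "run (block p i n) [] = Some (1 # replicate k' 1)"
    by (cases k) auto
  from run_last_passage[OF k] obtain y x where yx: "block p i n = (y @ [BetaNegAt 1]) @ x"
    "run y [] = Some (replicate k' 1)" "run x [] = Some []" by auto
  define l where "l = i + int (length (y @ [BetaNegAt 1]))"
  have u: "block p l n = x @ y @ [BetaNegAt 1]"
    using block_rotate[OF p(2) yx(1)] by (simp add: l_def)
  have w: "walk (src (p l)) (block p l n) (src (p l))"
    using walk_block[OF p(1), of l n] p(2) by (simp add: has_period_def)
  then have src: "src (p l) = 0" unfolding u by (auto simp: walk_append)
  have r: "run (block p l n) [] = Some (replicate (Suc k') 1)"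
    using run_append_Nil[OF yx(3,2)] unfolding u by (simp add: run_append_Some)
  have "block p l n \<noteq> concat (replicate j [BetaNeg, BetaNegAt 1])" for j
  proof
    assume eq: "block p l n = concat (replicate j [BetaNeg, BetaNegAt 1])"
    from arg_cong[OF eq, of length] have n: "n = 2 * j"
      by (simp add: length_concat sum_list_replicate)
    with p(2) have "j \<ge> 1" by (simp add: has_period_def)
    note n = n this
    have nth: "concat (replicate j [BetaNeg, BetaNegAt 1]) ! m =
        (if even m then BetaNeg else BetaNegAt 1)" if "m < 2 * j" for m j
      using that
    proof (induction j arbitrary: m)
      case (Suc j)
      then show ?case by (cases m; cases "m - 1") auto
    qed simp
    have p2: "p (l + m) = (if even m then BetaNeg else BetaNegAt 1)" for m
    proof -
      have "p (l + m) = shift p l (m mod int n)"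
        using has_period_mod[of "shift p l" n m, unfolded has_period_shift, OF p(2)] by (simp add: shift_def add.commute)
      also have "\<dots> = block p l n ! nat (m mod int n)"
        using n by (simp add: shift_def nat_less_iff add.commute)
      also have "\<dots> = (if even (nat (m mod int n)) then BetaNeg else BetaNegAt 1)"
        unfolding eq using n by (intro nth) (simp add: nat_less_iff)
      also have "even (nat (m mod int n)) \<longleftrightarrow> even m"
        using n by (simp add: even_nat_iff) (metis dvd_mod_iff dvd_triv_left)
      finally show ?thesis .
    qed
    have "p (m + 2) = p m" for m
      using p2[of "m - l"] p2[of "m + 2 - l"] by simp
    then have "has_period p 2" by (simp add: has_period_def)
    from smallest_period_le[OF this] p n show False by simp
  qed
  from unswapped_rotation[OF _ r _ this] w src obtain a b q x where
    "block p l n = a @ b" "b @ a = unswapped q x" "swappable q x"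
    unfolding u by auto
  then show ?thesis using block_rotate[OF p(2), of l a b] by metis
qed

lemma cyc_swapped_properties:
  assumes m: "swappable q x" and n: "length (swapped q x) = n"
  shows "cyc (swapped q x) \<in> fib_dyck_shift" "has_period (cyc (swapped q x)) n"
    "smallest_period (cyc (swapped q x)) = n" "negative_multiplier (cyc (swapped q x))"
    "block (cyc (swapped q x)) 0 n = swapped q x"
proof -
  let ?p = "cyc (swapped q x)"
  show per: "has_period ?p n" using has_period_cyc[of "swapped q x"] n by (simp add: swapped_def)
  show block: "block ?p 0 n = swapped q x" using block_cyc[of "swapped q x"] n by simp
  from run_swapped[OF m] obtain k where k: "run (swapped q x) [] = Some (0 # 0 # replicate k 1)" by blast
  show "?p \<in> fib_dyck_shift"
    using per walk_swapped[OF m] k by (auto intro!: fib_dyck_shiftI simp: block)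
  show sp: "smallest_period ?p = n"
  proof (rule smallest_period_eqI[OF per])
    fix a b assume "block ?p 0 n = a @ b" "b @ a = a @ b"
    then show "a = [] \<or> b = []" using swapped_rotation_trivial[OF m m] unfolding block by metis
  qed
  show "negative_multiplier ?p"
    unfolding negative_multiplier_iff sp
    by (intro exI[of _ 0] exI[of _ "0 # 0 # replicate k 1"]) (simp add: block k)
qed

text \<open>Rotating a word with a purely negative label into another such word rotates the label, so the
  two zeros in it survive.\<close>

lemma cyc_swapped_not_multiplier_one:
  assumes m: "swappable q x" and n: "length (swapped q x) = n"
  shows "shift_orbit (cyc (swapped q x)) \<notin> periodic_orbits n (has_multiplier_neg (multiplier_of [1]))"
proof
  assume "shift_orbit (cyc (swapped q x)) \<in> periodic_orbits n (has_multiplier_neg (multiplier_of [1]))"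
  then obtain p where p: "shift_orbit (cyc (swapped q x)) = shift_orbit p" "smallest_period p = n"
    "has_multiplier_neg (multiplier_of [1]) p"
    unfolding periodic_orbits_def by blast
  from p(2,3) obtain i k where k: "run (block p i n) [] = Some (replicate k 1)"
    unfolding has_multiplier_neg_iff by blast
  from p(1) obtain j where "p = shift (cyc (swapped q x)) j" unfolding shift_orbit_eq_iff by blast
  with k have k: "run (block (cyc (swapped q x)) (i + j) n) [] = Some (replicate k 1)" by simp
  from block_split_at[OF cyc_swapped_properties(2)[OF m n]] cyc_swapped_properties(5)[OF m n]
  obtain a b where ab: "swapped q x = a @ b" "block (cyc (swapped q x)) (i + j) n = b @ a" by metis
  from run_swapped[OF m] obtain k' where k': "run (swapped q x) [] = Some (0 # 0 # replicate k' 1)" by blast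
  obtain s where s: "run a [] = Some s" using k' unfolding ab(1) by (auto simp: run_append_Some)
  obtain t where t: "run b [] = Some t" using k unfolding ab(2) by (auto simp: run_append_Some)
  have "t @ s = 0 # 0 # replicate k' 1" using run_append_Nil[OF s t] k' unfolding ab(1) by simp
  moreover have "s @ t = replicate k 1" using run_append_Nil[OF t s] k unfolding ab(2) by simp
  ultimately have "0 \<in> set (replicate k (1 :: bit))" by (metis list.set_intros(1) set_append Un_commute)
  then show False by (auto split: if_splits)
qed

text \<open>The exchange injects the orbits with multiplier \<open>\<alpha>(1)\<^sub>-\<close> into the negative ones whose multiplier
  is different.\<close>

lemma twice_card_multiplier_one_le:
  assumes "n \<noteq> 2"
  shows "2 * card (periodic_orbits n (has_multiplier_neg (multiplier_of [1])))
    \<le> card (periodic_orbits n negative_multiplier)"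
proof -
  let ?M = "periodic_orbits n (has_multiplier_neg (multiplier_of [1]))"
  let ?N = "periodic_orbits n negative_multiplier"
  have "\<exists>q x. swappable q x \<and> length (swapped q x) = n \<and> orb = shift_orbit (cyc (unswapped q x))"
    if "orb \<in> ?M" for orb
  proof -
    from that obtain p where p: "orb = shift_orbit p" "p \<in> fib_dyck_shift" "periodic p"
      "smallest_period p = n" "has_multiplier_neg (multiplier_of [1]) p"
      unfolding periodic_orbits_def by blast
    then have per: "has_period p n" using has_period_smallest by blast
    from p unswapped_block_exists[OF p(2) per p(4) assms] obtain j q x where
      jqx: "block p j n = unswapped q x" "swappable q x"
      unfolding has_multiplier_neg_iff by blast
    then have "length (swapped q x) = n" by (metis length_swapped length_block)
    moreover have "orb = shift_orbit (cyc (unswapped q x))"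
      using shift_orbit_cyc_block[OF per, of j] jqx p by simp
    ultimately show ?thesis using jqx by blast
  qed
  then obtain q x where qx: "\<And>orb. orb \<in> ?M \<Longrightarrow> swappable (q orb) (x orb)"
    "\<And>orb. orb \<in> ?M \<Longrightarrow> length (swapped (q orb) (x orb)) = n"
    "\<And>orb. orb \<in> ?M \<Longrightarrow> orb = shift_orbit (cyc (unswapped (q orb) (x orb)))"
    by metis
  define f where "f orb = shift_orbit (cyc (swapped (q orb) (x orb)))" for orb
  have "inj_on f ?M"
  proof (rule inj_onI)
    fix orb orb' assume M: "orb \<in> ?M" "orb' \<in> ?M" and "f orb = f orb'"
    then obtain k where k: "cyc (swapped (q orb') (x orb')) = shift (cyc (swapped (q orb) (x orb))) k"
      unfolding f_def shift_orbit_eq_iff by blast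
    note props = cyc_swapped_properties[OF qx(1,2), OF M(1) M(1)]
    note props' = cyc_swapped_properties[OF qx(1,2), OF M(2) M(2)]
    from block_split_at[OF props(2), of k] props(5) props'(5) k obtain a b where
      ab: "swapped (q orb) (x orb) = a @ b" "swapped (q orb') (x orb') = b @ a"
      by (metis add_0_right block_shift add.commute)
    from swapped_rotation_trivial[OF qx(1)[OF M(1)] qx(1)[OF M(2)] ab] ab
    have "swapped (q orb) (x orb) = swapped (q orb') (x orb')" by auto
    from swapped_inj[OF qx(1)[OF M(1)] qx(1)[OF M(2)] this] qx(3)[OF M(1)] qx(3)[OF M(2)]
    show "orb = orb'" by simp
  qed
  moreover have "f ` ?M \<subseteq> ?N - ?M"
  proof
    fix r assume "r \<in> f ` ?M"
    then obtain orb where orb: "orb \<in> ?M" "r = shift_orbit (cyc (swapped (q orb) (x orb)))"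
      by (auto simp: f_def)
    note props = cyc_swapped_properties[OF qx(1,2), OF orb(1) orb(1)]
    from props(2) have "periodic (cyc (swapped (q orb) (x orb)))" unfolding periodic_def by blast
    with props have "r \<in> ?N" unfolding periodic_orbits_def orb(2) by blast
    with cyc_swapped_not_multiplier_one[OF qx(1,2), OF orb(1) orb(1)] orb(2) show "r \<in> ?N - ?M" by blast
  qed
  ultimately have "card ?M \<le> card (?N - ?M)"
    by (intro card_inj_on_le) (auto intro: finite_periodic_orbits)
  moreover have "?M \<subseteq> ?N"
  proof -
    have "negative_multiplier p" if one: "has_multiplier_neg (multiplier_of [1]) p" for p
    proof -
      from one obtain i k where "k \<ge> 1"
        "run (block p i (smallest_period p)) [] = Some (replicate k 1)"
        unfolding has_multiplier_neg_iff by blast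
      then show ?thesis unfolding negative_multiplier_iff by (intro exI conjI) auto
    qed
    then show ?thesis unfolding periodic_orbits_def by blast
  qed
  ultimately show ?thesis
    using card_Diff_subset[of ?M ?N] card_mono[of ?N ?M] finite_periodic_orbits by fastforce
qed

section \<open>Reversal exchanges negative and positive multipliers\<close>

fun rev_gen :: "gen \<Rightarrow> gen" where
  "rev_gen (Gneg i) = Gpos i"
| "rev_gen (Gpos i) = Gneg i"

text \<open>Reading words backwards and exchanging signs preserves the relations, which gives an
  anti-automorphism of the Dyck monoid.\<close>

fun rev_zero_word :: "gen list option \<Rightarrow> gen list option" where
  "rev_zero_word None = None"
| "rev_zero_word (Some w) = Some (rev (map rev_gen w))"

lemma rev_zero_word_fmult: "rev_zero_word (fmult x y) = fmult (rev_zero_word y) (rev_zero_word x)"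
  by (cases x; cases y) simp_all

lemma rev_zero_word_cong: "dyck_cong x y \<Longrightarrow> dyck_cong (rev_zero_word x) (rev_zero_word y)"
proof (induction rule: dyck_cong.induct)
  case (dc_mult x x' y y')
  then show ?case by (simp add: rev_zero_word_fmult dyck_cong.dc_mult)
next
  case (dc_trans x y z)
  then show ?case by (metis dyck_cong.dc_trans)
qed (auto intro: dyck_cong.intros)

lift_definition rev_dyck :: "dyck \<Rightarrow> dyck" is rev_zero_word
  by (rule rev_zero_word_cong)

lemma rev_dyck_mult: "rev_dyck (x * y) = rev_dyck y * rev_dyck x"
  by transfer (simp add: rev_zero_word_fmult dc_refl)

lemma rev_dyck_zero [simp]: "rev_dyck 0 = 0"
  by transfer (simp add: dc_refl)

lemma rev_dyck_one [simp]: "rev_dyck 1 = 1"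
  by transfer (simp add: dc_refl)

lemma rev_dyck_alpha_neg [simp]: "rev_dyck (alpha_neg i) = alpha_pos i"
  by transfer (simp add: dc_refl)

lemma rev_dyck_alpha_pos [simp]: "rev_dyck (alpha_pos i) = alpha_neg i"
  by transfer (simp add: dc_refl)

lemma rev_gen_rev_gen [simp]: "rev_gen (rev_gen g) = g"
  by (cases g) auto

lemma rev_zero_word_rev_zero_word [simp]: "rev_zero_word (rev_zero_word x) = x"
  by (cases x) (simp_all add: rev_map comp_def)

lemma rev_dyck_rev_dyck [simp]: "rev_dyck (rev_dyck x) = x"
  by transfer (simp add: dc_refl)

lemma rev_dyck_eq_iff: "rev_dyck x = y \<longleftrightarrow> x = rev_dyck y"
  by (metis rev_dyck_rev_dyck)

lemma rev_dyck_power: "rev_dyck (x ^ k) = rev_dyck x ^ k"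
  by (induction k) (simp_all add: rev_dyck_mult power_commutes)

lemma rev_dyck_neg_word: "rev_dyck (neg_word w) = prod_list (map alpha_pos (rev w))"
  by (induction w) (simp_all add: rev_dyck_mult)

text \<open>The same symmetry of the graph: \<open>rev_edge\<close> reverses the direction of each edge, and
  composed with time reversal it maps the shift to itself.\<close>

fun rev_edge :: "edge \<Rightarrow> edge" where
  "rev_edge (BetaNegAt i) = BetaPosAt i"
| "rev_edge (BetaPosAt i) = BetaNegAt i"
| "rev_edge BetaNeg = BetaPos"
| "rev_edge BetaPos = BetaNeg"

lemma rev_edge_rev_edge [simp]: "rev_edge (rev_edge e) = e"
  by (cases e) auto

lemma src_tgt_rev_edge [simp]: "src (rev_edge e) = tgt e" "tgt (rev_edge e) = src e"
  by (cases e; simp)+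

lemma edge_label_rev_edge: "edge_label (rev_edge e) = rev_dyck (edge_label e)"
  by (cases e) auto

lemma path_label_rev: "path_label (rev (map rev_edge u)) = rev_dyck (path_label u)"
  by (induction u) (simp_all add: path_label_def rev_dyck_mult edge_label_rev_edge)

lemma admissible_rev: "admissible (rev (map rev_edge u)) \<longleftrightarrow> admissible u"
proof -
  have "directed_path (rev (map rev_edge u)) \<longleftrightarrow> directed_path u"
    by (simp add: directed_path_def successively_map eq_commute)
  then show ?thesis by (simp add: admissible_def path_label_rev rev_dyck_eq_iff)
qed

definition reversal :: "(int \<Rightarrow> edge) \<Rightarrow> int \<Rightarrow> edge" where
  "reversal p = (\<lambda>i. rev_edge (p (- i)))"

lemma reversal_reversal [simp]: "reversal (reversal p) = p"
  by (simp add: reversal_def)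

lemma inj_reversal: "inj reversal"
  by (metis injI reversal_reversal)

lemma reversal_shift: "reversal (shift p k) = shift (reversal p) (- k)"
  by (simp add: reversal_def shift_def)

lemma shift_orbit_reversal: "shift_orbit (reversal p) = reversal ` shift_orbit p"
proof -
  have "range (shift (reversal p)) = range (\<lambda>k. shift (reversal p) (- k))"
    using surj_uminus by (metis (no_types) image_image)
  then show ?thesis by (simp add: shift_orbit_alt image_image reversal_shift)
qed

lemma block_reversal: "block (reversal p) i n = rev (map rev_edge (block p (1 - i - int n) n))"
  by (rule nth_equalityI) (auto simp: reversal_def rev_nth algebra_simps)

lemma exists_reflected_iff: "(\<exists>i. P (1 - i - int n)) \<longleftrightarrow> (\<exists>i. P i)"
proof
  assume "\<exists>i. P i"
  then obtain i where "P i" ..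
  then show "\<exists>i. P (1 - i - int n)" by (intro exI[of _ "1 - i - int n"]) simp
qed blast

lemma reversal_in_shift: "p \<in> fib_dyck_shift \<Longrightarrow> reversal p \<in> fib_dyck_shift"
  by (simp add: fib_dyck_shift_def block_reversal admissible_rev)

lemma reversal_in_shift_iff: "reversal p \<in> fib_dyck_shift \<longleftrightarrow> p \<in> fib_dyck_shift"
  by (metis reversal_in_shift reversal_reversal)

lemma has_period_reversal: "has_period p n \<Longrightarrow> has_period (reversal p) n"
proof -
  assume *: "has_period p n"
  have "p (- i - int n) = p (- i)" for i
    using * unfolding has_period_def by (metis diff_add_cancel)
  with * show ?thesis by (simp add: has_period_def reversal_def)
qed

lemma has_period_reversal_iff: "has_period (reversal p) n \<longleftrightarrow> has_period p n"
  by (metis has_period_reversal reversal_reversal)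

lemma smallest_period_reversal: "smallest_period (reversal p) = smallest_period p"
  by (simp add: smallest_period_def has_period_reversal_iff)

lemma periodic_reversal: "periodic (reversal p) \<longleftrightarrow> periodic p"
  by (simp add: periodic_def has_period_reversal_iff)

lemma rev_dyck_in_dyck_plus: "rev_dyck x \<in> dyck_plus \<longleftrightarrow> x \<in> dyck_minus"
proof -
  have "rev_dyck x = prod_list (map alpha_pos w) \<longleftrightarrow> x = neg_word (rev w)" for w
    by (metis rev_dyck_neg_word rev_dyck_rev_dyck rev_rev_ident)
  then show ?thesis
    unfolding dyck_plus_def dyck_minus_def by simp (metis rev_is_Nil_conv rev_rev_ident)
qed

lemma positive_multiplier_reversal: "positive_multiplier (reversal p) \<longleftrightarrow> negative_multiplier p"
  unfolding positive_multiplier_def negative_multiplier_def smallest_period_reversal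
    block_reversal path_label_rev rev_dyck_in_dyck_plus
  by (rule exists_reflected_iff)

lemma has_multiplier_pos_reversal:
  "has_multiplier_pos \<mu> (reversal p) \<longleftrightarrow> has_multiplier_neg \<mu> p"
proof -
  have eq: "rev_dyck x = prod_list (map alpha_pos (rev w)) ^ k \<longleftrightarrow> x = neg_word w ^ k" for x w k
    by (metis rev_dyck_neg_word rev_dyck_power rev_dyck_rev_dyck)
  show ?thesis
    unfolding has_multiplier_pos_def has_multiplier_neg_def smallest_period_reversal
      block_reversal path_label_rev eq
    by (rule exists_reflected_iff)
qed

lemma periodic_orbits_reversal:
  assumes "\<And>p. Q (reversal p) \<longleftrightarrow> P p"
  shows "periodic_orbits n Q = (`) reversal ` periodic_orbits n P"
proof -
  let ?S = "\<lambda>P. {p. p \<in> fib_dyck_shift \<and> periodic p \<and> smallest_period p = n \<and> P p}"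
  have "?S Q = reversal ` ?S P"
  proof (intro equalityI subsetI)
    fix p assume "p \<in> ?S Q"
    moreover have "Q p \<longleftrightarrow> P (reversal p)" using assms[of "reversal p"] by simp
    ultimately have "reversal p \<in> ?S P"
      by (simp add: reversal_in_shift_iff periodic_reversal smallest_period_reversal)
    then show "p \<in> reversal ` ?S P" by (rule image_eqI[rotated]) simp
  qed (auto simp: assms reversal_in_shift_iff periodic_reversal smallest_period_reversal)
  moreover have "periodic_orbits n R = shift_orbit ` ?S R" for R
    unfolding periodic_orbits_def by blast
  ultimately show ?thesis by (simp add: image_image shift_orbit_reversal)
qed

lemma card_periodic_orbits_reversal:
  assumes "\<And>p. Q (reversal p) \<longleftrightarrow> P p"
  shows "card (periodic_orbits n Q) = card (periodic_orbits n P)"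
  unfolding periodic_orbits_reversal[of Q P, OF assms]
  by (intro card_image inj_onI) (simp add: inj_image_eq_iff[OF inj_reversal])

section \<open>Period two\<close>

text \<open>Of the closed walks of length two with two different edges, the only ones with a nonempty
  negative label are the two rotations of \<open>\<beta>\<^sup>- \<beta>\<^sup>-(1)\<close>.\<close>

lemma negative_orbits_two:
  "periodic_orbits 2 negative_multiplier \<subseteq> {shift_orbit (cyc [BetaNeg, BetaNegAt 1])}"
proof
  fix orb assume "orb \<in> periodic_orbits 2 negative_multiplier"
  then obtain p where p: "orb = shift_orbit p" "p \<in> fib_dyck_shift" "periodic p"
    "smallest_period p = 2" "negative_multiplier p"
    unfolding periodic_orbits_def by blast
  from p(3,4) have per: "has_period p 2" by (metis has_period_smallest)
  from p(4,5) obtain i t where t: "t \<noteq> []" "run (block p i 2) [] = Some t"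
    unfolding negative_multiplier_iff by auto
  have b: "block p i 2 = [p i, p (i + 1)]" by (simp add: numeral_2_eq_2 block_Suc)
  have "walk (src (p i)) (block p i 2) (src (p i))"
    using walk_block[OF p(2), of i 2] per by (simp add: has_period_def)
  then have w: "tgt (p i) = src (p (i + 1))" "tgt (p (i + 1)) = src (p i)"
    unfolding b by auto
  have "p i \<noteq> p (i + 1)"
  proof
    assume eq: "p i = p (i + 1)"
    have "shift p i = shift p (i + 1)"
      by (rule shift_eq_shift[OF per per])
        (use eq per in \<open>simp add: numeral_2_eq_2 block_Suc has_period_def algebra_simps\<close>)
    from fun_cong[OF this] have "p (j + 1) = p j" for j
      unfolding shift_def by (metis add.assoc diff_add_cancel)
    then have "has_period p 1" by (simp add: has_period_def)
    from smallest_period_le[OF this] p(4) show False by simp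
  qed
  moreover have "p i \<in> UNIV" "p (i + 1) \<in> UNIV" by simp_all
  ultimately have "block p i 2 = [BetaNeg, BetaNegAt 1] \<or>
      block p i 2 = [BetaNegAt 1] @ [BetaNeg]"
    using w t unfolding UNIV_edge b by auto
  then obtain j where "block p j 2 = [BetaNeg, BetaNegAt 1]"
    using block_rotate[OF per, of i "[BetaNegAt 1]" "[BetaNeg]"] by auto
  with shift_orbit_cyc_block[OF per, of j] p(1)
  show "orb \<in> {shift_orbit (cyc [BetaNeg, BetaNegAt 1])}" by simp
qed

lemma multiplier_one_orbit_two:
  "shift_orbit (cyc [BetaNeg, BetaNegAt 1]) \<in>
     periodic_orbits 2 (has_multiplier_neg (multiplier_of [1]))"
proof -
  let ?u = "[BetaNeg, BetaNegAt 1]"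
  have per: "has_period (cyc ?u) 2" using has_period_cyc[of ?u] by (simp add: numeral_2_eq_2)
  have block: "block (cyc ?u) 0 2 = ?u" using block_cyc[of ?u] by (simp add: numeral_2_eq_2)
  have "cyc ?u \<in> fib_dyck_shift"
    by (rule fib_dyck_shiftI[OF per]) (simp_all add: block)
  moreover have sp: "smallest_period (cyc ?u) = 2"
    by (rule smallest_period_eqI[OF per]) (auto simp: block Cons_eq_append_conv append_eq_Cons_conv)
  moreover have "has_multiplier_neg (multiplier_of [1]) (cyc ?u)"
    unfolding has_multiplier_neg_iff sp by (intro exI[of _ 0] exI[of _ 1]) (simp add: block)
  moreover have "periodic (cyc ?u)" using per unfolding periodic_def by blast
  ultimately show ?thesis unfolding periodic_orbits_def by blast
qed

text \<open>The only negative orbit and its mirror image both have the multiplier \<open>\<alpha>(1)\<close>, while there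
  is just one negative and one positive orbit.\<close>

lemma exceptional_two: "exceptional (multiplier_of [1]) 2"
proof -
  let ?M = "periodic_orbits 2 (has_multiplier_neg (multiplier_of [1]))"
  let ?P = "periodic_orbits 2 (has_multiplier_pos (multiplier_of [1]))"
  let ?o = "shift_orbit (cyc [BetaNeg, BetaNegAt 1])"
  have ne: "?o \<noteq> reversal ` ?o"
  proof
    assume "?o = reversal ` ?o"
    then obtain k where "reversal (cyc [BetaNeg, BetaNegAt 1]) = shift (cyc [BetaNeg, BetaNegAt 1]) k"
      unfolding shift_orbit_reversal[symmetric] shift_orbit_eq_iff by blast
    from fun_cong[OF this, of 0] show False
      by (auto simp: reversal_def shift_def cyc_def nth_Cons split: nat.splits)
  qed
  have "reversal ` ?o \<in> ?P"
    unfolding periodic_orbits_reversal[of "has_multiplier_pos (multiplier_of [1])"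
        "has_multiplier_neg (multiplier_of [1])", OF has_multiplier_pos_reversal]
    using multiplier_one_orbit_two by (rule imageI)
  with multiplier_one_orbit_two have "{?o, reversal ` ?o} \<subseteq> ?M \<union> ?P" by blast
  then have "card {?o, reversal ` ?o} \<le> card (?M \<union> ?P)"
    by (intro card_mono) (simp_all add: finite_periodic_orbits)
  with ne have "2 \<le> card (?M \<union> ?P)" by simp
  moreover have "card (periodic_orbits 2 negative_multiplier) \<le> 1"
    using card_mono[OF _ negative_orbits_two] by simp
  moreover have "card (periodic_orbits 2 positive_multiplier) =
      card (periodic_orbits 2 negative_multiplier)"
    by (rule card_periodic_orbits_reversal) (rule positive_multiplier_reversal)
  ultimately show ?thesis unfolding exceptional_def by simp
qed

theorem propositionM1:
  fixes n :: nat
  assumes "n \<ge> 1"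
  shows "exceptional (multiplier_of [1]) n \<longleftrightarrow> n = 2"
proof
  assume exc: "exceptional (multiplier_of [1]) n"
  show "n = 2"
  proof (rule ccontr)
    assume "n \<noteq> 2"
    let ?M = "periodic_orbits n (has_multiplier_neg (multiplier_of [1]))"
    let ?P = "periodic_orbits n (has_multiplier_pos (multiplier_of [1]))"
    have "card ?P = card ?M"
      by (rule card_periodic_orbits_reversal) (rule has_multiplier_pos_reversal)
    then have "card (?M \<union> ?P) \<le> 2 * card ?M"
      using card_Un_le[of ?M ?P] by simp
    with twice_card_multiplier_one_le[OF \<open>n \<noteq> 2\<close>] exc show False
      unfolding exceptional_def by simp
  qed
qed (simp add: exceptional_two)

end
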